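(* Let $m\geq 3$ and $r\geq 2$ be integers, let $i_1,\ldots,i_m$ be non-negative integers and $s_1,\ldots,s_m$ positive integers. If $i_m<rs_m$ and if for every $t=1,\ldots,m-1$ $$i_t\leq s_t\min\left\{\frac{\sqrt[m-1]{r}-1}{\sqrt[m-1]{r}-\frac{1}{r}},\ \frac{\sqrt[m-2]{2}-1}{\sqrt[m-2]{2}-\frac{1}{2}}\right\},$$ then $$D(i_1,\ldots,i_m,r,s_1,\ldots,s_m)\leq s_1\cdots s_m-\Big(s_1-\frac{i_1}{r}\Big)\cdots\Big(s_m-\frac{i_m}{r}\Big).$$
   Context: The function $D$ is defined recursively for integers $r\geq 1$, $i_1,\ldots,i_m\geq 0$ and $s_1,\ldots,s_m\geq 1$ as follows. For one variable, $D(i_1,r,s_1)=\min\{\lfloor i_1/r\rfloor, s_1\}$. For $m\geq 2$, $$D(i_1,\ldots,i_m,r,s_1,\ldots,s_m)=\max_{(u_1,\ldots,u_r)\in A(i_m,r,s_m)}\Big\{(s_m-u_1-\cdots-u_r)D(i_1,\ldots,i_{m-1},r,s_1,\ldots,s_{m-1})+\sum_{k=1}^{r-1}u_k D(i_1,\ldots,i_{m-1},r-k,s_1,\ldots,s_{m-1})+u_r s_1\cdots s_{m-1}\Big\},$$ where $$A(i_m,r,s_m)=\{(u_1,\ldots,u_r)\in\mathbb{N}_0^r \mid u_1+\cdots+u_r\leq s_m \text{ and } u_1+2u_2+\cdots+ru_r\leq i_m\}.$$ *)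

theory Defs
  imports Complex_Main "HOL-Library.FuncSet"
begin

text \<open>
  A vector \<open>(u\<^sub>1, \<dots>, u\<^sub>r)\<close> of natural numbers is an extensional function on \<open>{1..r}\<close>.
  The set is finite and contains the zero vector, so \<open>Max\<close> below is a proper maximum.
\<close>

definition A :: "nat \<Rightarrow> nat \<Rightarrow> nat \<Rightarrow> (nat \<Rightarrow> nat) set" where
  "A i r s = {u \<in> {1..r} \<rightarrow>\<^sub>E UNIV. (\<Sum>k=1..r. u k) \<le> s \<and> (\<Sum>k=1..r. k * u k) \<le> i}"

lemma finite_A: "finite (A i r s)"
proof (rule finite_subset)
  show "A i r s \<subseteq> {1..r} \<rightarrow>\<^sub>E {..s}"
  proof
    fix u assume u: "u \<in> A i r s"
    have "u k \<le> s" if "k \<in> {1..r}" for k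
    proof -
      have "u k \<le> (\<Sum>k=1..r. u k)"
        using that by (intro member_le_sum) auto
      with u show ?thesis by (simp add: A_def)
    qed
    with u show "u \<in> {1..r} \<rightarrow>\<^sub>E {..s}"
      by (auto simp: A_def PiE_iff)
  qed
qed (intro finite_PiE; simp)

lemma zero_in_A: "(\<lambda>k\<in>{1..r}. 0) \<in> A i r s"
  by (simp add: A_def)

text \<open>
  \<open>D m r i s\<close> stands for \<open>D(i\<^sub>1, \<dots>, i\<^sub>m, r, s\<^sub>1, \<dots>, s\<^sub>m)\<close>, where \<open>i\<^sub>t\<close> is \<open>i t\<close> and
  \<open>s\<^sub>t\<close> is \<open>s t\<close>; only the arguments \<open>1 \<le> t \<le> m\<close> matter. It is meant for \<open>m \<ge> 1\<close> and
  \<open>r \<ge> 1\<close>; the value for \<open>m = 0\<close> is a dummy that is never used by the recursion. The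
  subtraction from \<open>s\<^sub>m\<close> does not truncate, by the first constraint in \<^const>\<open>A\<close>.
\<close>

fun D :: "nat \<Rightarrow> nat \<Rightarrow> (nat \<Rightarrow> nat) \<Rightarrow> (nat \<Rightarrow> nat) \<Rightarrow> nat" where
  "D 0 r i s = 0"
| "D (Suc 0) r i s = min (i 1 div r) (s 1)"
| "D (Suc (Suc n)) r i s =
     (let m = Suc (Suc n) in
      Max ((\<lambda>u. (s m - (\<Sum>k=1..r. u k)) * D (Suc n) r i s
               + (\<Sum>k=1..r-1. u k * D (Suc n) (r - k) i s)
               + u r * (\<Prod>t=1..m-1. s t)) ` A (i m) r (s m)))"

end

theory Submission
  imports Defs "HOL-Analysis.Convex"
begin

text \<open>
  Write \<open>G\<^sub>n(j)\<close> for the product of \<open>s\<^sub>t - i\<^sub>t / j\<close> over \<open>t \<le> n\<close> and \<open>P\<^sub>n\<close> for the product of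
  the \<open>s\<^sub>t\<close>, so that the claim is \<open>D\<^sub>m(r) \<le> P\<^sub>m - G\<^sub>m(r)\<close>. Inserting such bounds for
  \<open>D\<^sub>n(j)\<close>, \<open>j \<le> r\<close>, into the recursion for \<open>D\<^sub>n\<^sub>+\<^sub>1(r)\<close> produces a linear optimization problem
  in \<open>u\<close>. If \<open>G\<^sub>n(j) / j \<ge> G\<^sub>n(r) / r\<close> for all \<open>1 \<le> j \<le> r\<close>, then one unit of \<open>u\<^sub>k\<close> gains at
  most \<open>k G\<^sub>n(r) / r\<close>, and the single budget \<open>\<Sum> k u\<^sub>k \<le> i\<^sub>n\<^sub>+\<^sub>1\<close> already gives the bound with
  \<open>n + 1\<close> in place of \<open>n\<close> (lemma \<open>D_Suc_le\<close>).

  The inequality between the quotients \<open>G\<^sub>n(j) / j\<close> is proved factor by factor, giving each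
  of the factors an \<open>N\<close>-th root of the denominator, where \<open>N \<ge> n\<close>. With \<open>y = 1 / j\<close> a factor
  becomes \<open>y\<^sup>a (s - i y)\<close> for \<open>a = 1 / N\<close>, which is a concave function of \<open>y\<close>. Concavity makes
  it enough to compare \<open>y = 1\<close> with \<open>y = 1 / r\<close>, and this comparison is exactly the
  hypothesis on \<open>i\<^sub>t\<close> (lemma \<open>weight_condition_iff\<close>). Two comparisons are needed. In the last step of
  the recursion \<open>N = m - 1\<close> and \<open>r\<close> is the given multiplicity, which is the first term of the
  minimum. In the earlier steps \<open>N = m - 2\<close> serves for all \<open>n \<le> m - 2\<close>, but every
  multiplicity \<open>k \<le> r\<close> occurs; concavity again reduces all \<open>k \<ge> 2\<close> to \<open>k = 2\<close>, which is the
  second term.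
\<close>

section \<open>Comparison of single factors\<close>

text \<open>
  The function is \<open>y\<^sup>a (s - i y)\<close>. Both its summands are concave because \<open>a \<le> 1 \<le> a + 1\<close>.
\<close>

lemma concave_on_powr_diff:
  fixes a s i :: real
  assumes "0 \<le> a" "a \<le> 1" "0 \<le> s" "0 \<le> i"
  shows "concave_on {0<..} (\<lambda>y. s * y powr a - i * y powr (a + 1))"
proof -
  have "concave_on {0<..} (\<lambda>y::real. y powr a)"
  proof (rule f''_le0_imp_concave)
    fix y :: real assume "y \<in> {0<..}"
    then have y: "y > 0" by simp
    show "((\<lambda>y. y powr a) has_real_derivative a * y powr (a - 1)) (at y)"
      using y by (auto intro!: derivative_eq_intros)
    show "((\<lambda>y. a * y powr (a - 1)) has_real_derivative
            a * ((a - 1) * y powr (a - 1 - 1))) (at y)"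
      using y by (auto intro!: derivative_eq_intros)
    show "a * ((a - 1) * y powr (a - 1 - 1)) \<le> 0"
      using assms by (intro mult_nonneg_nonpos mult_nonpos_nonneg) auto
  qed simp
  then have "concave_on {0<..} (\<lambda>y::real. s * y powr a)"
    using assms by (intro concave_on_cmul)
  moreover have "convex_on {0<..} (\<lambda>y::real. i * y powr (a + 1))"
    using assms by (intro convex_on_cmul powr_convex) auto
  ultimately show ?thesis
    by (rule concave_on_diff)
qed

lemma powr_diff_inverse:
  fixes a s i n :: real
  assumes "n > 0"
  shows "s * (1 / n) powr a - i * (1 / n) powr (a + 1) = (s - i / n) / n powr a"
  using assms by (simp add: powr_divide powr_add field_simps)

text \<open>
  The comparison of the two end points of \<open>[1/k, 1]\<close> passes to the point \<open>1/j\<close> between them.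
\<close>

lemma factor_ratio_le:
  fixes a s i :: real and j k :: nat
  assumes a: "0 \<le> a" "a \<le> 1" and "0 \<le> s" "0 \<le> i"
    and jk: "1 \<le> j" "j \<le> k"
    and ends: "s - i / k \<le> k powr a * (s - i)"
  shows "(j / k) powr a * (s - i / k) \<le> s - i / j"
proof -
  define \<phi> where "\<phi> y = s * y powr a - i * y powr (a + 1)" for y :: real
  have conc: "concave_on {1 / real k..1} \<phi>"
    unfolding \<phi>_def concave_on_def
    by (rule convex_on_subset[OF concave_on_powr_diff[unfolded concave_on_def]])
       (use assms in \<open>auto intro: less_le_trans[of 0 "1 / real k"]\<close>)
  have \<phi>_inverse: "\<phi> (1 / n) = (s - i / n) / n powr a" if "n > 0" for n :: real
    using that unfolding \<phi>_def by (rule powr_diff_inverse)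
  have pos: "real k powr a > 0" "real j powr a > 0"
    using jk by auto
  have "\<phi> (1 / k) \<le> \<phi> 1"
    using ends pos jk \<phi>_inverse[of k] \<phi>_inverse[of 1] by (simp add: divide_le_eq mult.commute)
  moreover have "min (\<phi> (1 / k)) (\<phi> 1) \<le> \<phi> (1 / j)"
    by (rule concave_on_ge_min[OF conc]) (use jk in \<open>auto simp: divide_simps\<close>)
  ultimately have "\<phi> (1 / k) \<le> \<phi> (1 / j)"
    by simp
  then show ?thesis
    using pos jk \<phi>_inverse[of k] \<phi>_inverse[of j]
    by (simp add: powr_divide divide_simps mult_ac)
qed

text \<open>
  For \<open>k \<ge> 2\<close> the point \<open>1/2\<close> lies between \<open>1/k\<close> and \<open>1\<close>, so a concave function with a larger value at \<open>1/k\<close>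
  than at \<open>1\<close> would also have a larger value at \<open>1/2\<close> than at \<open>1\<close>.
\<close>

lemma endpoint_comparison_from_two:
  fixes a s i :: real and k :: nat
  assumes a: "0 \<le> a" "a \<le> 1" and "0 \<le> s" "0 \<le> i" and "k \<ge> 1"
    and two: "s - i / 2 \<le> 2 powr a * (s - i)"
  shows "s - i / k \<le> k powr a * (s - i)"
proof (cases "k = 1")
  case False
  define \<phi> where "\<phi> y = s * y powr a - i * y powr (a + 1)" for y :: real
  have k: "real k \<ge> 2" using False \<open>k \<ge> 1\<close> by simp
  have \<phi>_inverse: "\<phi> (1 / n) = (s - i / n) / n powr a" if "n > 0" for n :: real
    using that unfolding \<phi>_def by (rule powr_diff_inverse)
  have conc: "concave_on {0<..} \<phi>"
    unfolding \<phi>_def by (rule concave_on_powr_diff) (use assms in auto)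
  \<comment> \<open>the weight for which \<open>1/2\<close> is the combination of \<open>1/k\<close> and \<open>1\<close>\<close>
  define w where "w = (real k - 2) / (2 * (real k - 1))"
  have w: "0 \<le> w" "w < 1"
    using k by (auto simp: w_def divide_simps)
  have "1 - w = k / (2 * (real k - 1))"
    using k by (simp add: w_def field_simps)
  then have half: "(1 - w) * (1 / k) + w = 1/2"
    using k by (simp add: w_def divide_simps)
  have "(1 - w) * \<phi> (1 / k) + w * \<phi> 1 \<le> \<phi> (1/2)"
    using concave_onD[OF conc, of w "1 / k" 1] w k
    unfolding real_scaleR_def mult_1_right half by simp
  also have "\<phi> (1/2) \<le> \<phi> 1"
    using two \<phi>_inverse[of 2] \<phi>_inverse[of 1] by (simp add: divide_le_eq mult.commute)
  finally have "(1 - w) * \<phi> (1 / k) \<le> (1 - w) * \<phi> 1"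
    by (simp add: algebra_simps)
  then have "\<phi> (1 / k) \<le> \<phi> 1"
    using w by simp
  then show ?thesis
    using k \<phi>_inverse[of k] \<phi>_inverse[of 1] by (simp add: divide_le_eq mult.commute)
qed simp

text \<open>
  With \<open>\<rho> = k\<^sup>a\<close>, the bound on \<open>i\<close> is the comparison of end points, solved for \<open>i\<close>.
\<close>

lemma weight_condition_iff:
  fixes s i k \<rho> :: real
  assumes "k \<ge> 1" "\<rho> > 1"
  shows "i \<le> s * ((\<rho> - 1) / (\<rho> - 1 / k)) \<longleftrightarrow> s - i / k \<le> \<rho> * (s - i)"
proof -
  have "\<rho> - 1 / k > 0"
    using assms by (smt (verit) divide_le_eq_1_pos)
  then have "i \<le> s * ((\<rho> - 1) / (\<rho> - 1 / k)) \<longleftrightarrow> i * (\<rho> - 1 / k) \<le> s * (\<rho> - 1)"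
    by (simp add: le_divide_eq)
  then show ?thesis
    by (simp add: algebra_simps)
qed

text \<open>
  This keeps all factors \<open>s - i / j\<close> nonnegative for \<open>j \<ge> 1\<close>, so that inequalities between factors can
  be multiplied.
\<close>

lemma weight_condition_imp_le:
  fixes s i k \<rho> :: real
  assumes "k \<ge> 1" "\<rho> > 1" "0 \<le> s" "i \<le> s * ((\<rho> - 1) / (\<rho> - 1 / k))"
  shows "i \<le> s"
proof -
  have "(\<rho> - 1) / (\<rho> - 1 / k) \<le> 1"
    using assms(1,2) by (smt (verit) divide_le_eq_1_pos)
  then show ?thesis
    using assms(3,4) by (smt (verit) mult_left_le)
qed

section \<open>Comparison of products\<close>

text \<open>
  Each factor contributes \<open>(j/k)\<^bsup>1/N\<^esup>\<close>, so \<open>n \<le> N\<close> factors cost at most one factor \<open>j/k\<close>.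
\<close>

lemma prod_ratio_le:
  fixes s i :: "nat \<Rightarrow> real" and j k n N :: nat
  assumes "n \<le> N" "N \<ge> 1" and jk: "1 \<le> j" "j \<le> k"
    and nonneg: "\<And>t. t \<in> {1..n} \<Longrightarrow> 0 \<le> s t - i t / k"
    and factors: "\<And>t. t \<in> {1..n} \<Longrightarrow>
      (j / k) powr (1 / N) * (s t - i t / k) \<le> s t - i t / j"
  shows "j / k * (\<Prod>t=1..n. s t - i t / k) \<le> (\<Prod>t=1..n. s t - i t / j)"
proof -
  define q where "q = (real j / real k) powr (1 / N)"
  have q: "0 \<le> q" "q \<le> 1"
    using jk by (auto simp: q_def intro!: powr_le1)
  have "real j / real k = q ^ N"
    using jk \<open>N \<ge> 1\<close> by (simp add: q_def powr_power)
  also have "\<dots> \<le> q ^ n"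
    using q \<open>n \<le> N\<close> by (intro power_decreasing)
  finally have "j / k * (\<Prod>t=1..n. s t - i t / k) \<le> q ^ n * (\<Prod>t=1..n. s t - i t / k)"
    using nonneg by (intro mult_right_mono prod_nonneg) auto
  also have "\<dots> = (\<Prod>t=1..n. q * (s t - i t / k))"
    by (simp add: prod.distrib)
  also have "\<dots> \<le> (\<Prod>t=1..n. s t - i t / j)"
    using q nonneg factors by (intro prod_mono) (auto simp: q_def)
  finally show ?thesis .
qed

section \<open>The recursion\<close>

text \<open>
  The step is stated for an arbitrary number \<open>g\<close> in the role of \<open>G\<^sub>n(r)\<close>. The bounds on the
  \<open>D\<^sub>n(j)\<close> make the objective at most \<open>S P - S g\<close> for \<open>u = 0\<close>, where \<open>S = s\<^sub>n\<^sub>+\<^sub>1\<close>, and each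
  unit of \<open>u\<^sub>k\<close> raises this estimate by \<open>k g / r\<close>. For \<open>k = r\<close> the rise is \<open>g\<close>, so the
  separate last term of the recursion fits the same pattern as the others.
\<close>

lemma D_Suc_le:
  fixes g :: real
  assumes "r \<ge> 1" "n \<ge> 1" "g \<ge> 0"
    and D_le: "\<And>j::nat. 1 \<le> j \<Longrightarrow> j \<le> r \<Longrightarrow>
      real (D n j i s) \<le> (\<Prod>t=1..n. real (s t)) - j / r * g"
  shows "real (D (Suc n) r i s)
    \<le> (\<Prod>t=1..Suc n. real (s t)) - g * (s (Suc n) - i (Suc n) / r)"
proof -
  define P where "P = (\<Prod>t=1..n. s t)"
  define S where "S = s (Suc n)"
  define I where "I = i (Suc n)"
  define val where "val u = (S - (\<Sum>k=1..r. u k)) * D n r i s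
    + (\<Sum>k=1..r-1. u k * D n (r - k) i s) + u r * P" for u
  have "D (Suc n) r i s = Max (val ` A I r S)"
    using \<open>n \<ge> 1\<close> by (cases n) (simp_all add: val_def[abs_def] P_def S_def I_def)
  moreover have "Max (val ` A I r S) \<in> val ` A I r S"
    using finite_A zero_in_A[of r I S] by (intro Max_in) auto
  ultimately obtain u where u: "u \<in> A I r S" and D_eq: "D (Suc n) r i s = val u"
    by auto
  have sum_u: "(\<Sum>k=1..r. u k) \<le> S" and weighted: "(\<Sum>k=1..r. k * u k) \<le> I"
    using u by (auto simp: A_def)
  have split_last: "{1..r} = insert r {1..r-1}" 
    using \<open>r \<ge> 1\<close> by auto
  have "real (val u) = (S - (\<Sum>k=1..r. real (u k))) * D n r i s
      + ((\<Sum>k=1..r-1. u k * real (D n (r - k) i s)) + u r * real P)"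
    using sum_u by (simp add: val_def of_nat_diff)
  also have "\<dots> \<le> (S - (\<Sum>k=1..r. real (u k))) * (P - g)
      + ((\<Sum>k=1..r-1. u k * (P - (r - k) / r * g)) + u r * (P - (r - r) / r * g))"
  proof (intro add_mono mult_left_mono sum_mono)
    show "real (D n r i s) \<le> P - g"
      using D_le[of r] \<open>r \<ge> 1\<close> by (simp add: P_def)
    show "0 \<le> S - (\<Sum>k=1..r. real (u k))"
      using sum_u by (simp flip: of_nat_sum)
    show "real (D n (r - k) i s) \<le> P - (r - k) / r * g" if "k \<in> {1..r-1}" for k
      using D_le[of "r - k"] that by (auto simp: P_def of_nat_diff)
  qed (use \<open>r \<ge> 1\<close> in auto)
  also have "\<dots> = (S - (\<Sum>k=1..r. real (u k))) * (P - g)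
      + (\<Sum>k=1..r. u k * (P - (r - k) / r * g))"
    unfolding split_last using \<open>r \<ge> 1\<close> by (subst (2) sum.insert) auto
  also have "(\<Sum>k=1..r. u k * (P - (r - k) / r * g))
      = (\<Sum>k=1..r. u k * (P - g) + g / r * (k * u k))"
    using \<open>r \<ge> 1\<close> by (intro sum.cong) (auto simp: field_simps)
  also have "\<dots> = (\<Sum>k=1..r. real (u k)) * (P - g) + g / r * (\<Sum>k=1..r. k * u k)"
    by (simp add: sum.distrib sum_distrib_left sum_distrib_right)
  also have "(S - (\<Sum>k=1..r. real (u k))) * (P - g) + \<dots>
      = S * (P - g) + g / r * (\<Sum>k=1..r. k * u k)"
    by (simp add: algebra_simps)
  also have "\<dots> \<le> S * (P - g) + g / r * I"
    using weighted \<open>g \<ge> 0\<close> by (intro add_left_mono mult_left_mono) (simp_all only: of_nat_le_iff, simp)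
  finally show ?thesis
    using D_eq by (simp add: P_def S_def I_def algebra_simps)
qed

lemma D_Suc_le_prod:
  assumes "r \<ge> 1" "n \<ge> 1"
    and nonneg: "\<And>t. t \<in> {1..n} \<Longrightarrow> 0 \<le> real (s t) - i t / r"
    and ratio: "\<And>j::nat. 1 \<le> j \<Longrightarrow> j \<le> r \<Longrightarrow>
      j / r * (\<Prod>t=1..n. real (s t) - i t / r) \<le> (\<Prod>t=1..n. real (s t) - i t / j)"
    and D_le: "\<And>j::nat. 1 \<le> j \<Longrightarrow> j \<le> r \<Longrightarrow>
      real (D n j i s) \<le> (\<Prod>t=1..n. real (s t)) - (\<Prod>t=1..n. real (s t) - i t / j)"
  shows "real (D (Suc n) r i s)
    \<le> (\<Prod>t=1..Suc n. real (s t)) - (\<Prod>t=1..Suc n. real (s t) - i t / r)"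
proof -
  define g where "g = (\<Prod>t=1..n. real (s t) - i t / r)"
  have "real (D (Suc n) r i s)
      \<le> (\<Prod>t=1..Suc n. real (s t)) - g * (s (Suc n) - i (Suc n) / r)"
  proof (rule D_Suc_le)
    show "real (D n j i s) \<le> (\<Prod>t=1..n. real (s t)) - j / r * g"
      if "1 \<le> j" "j \<le> r" for j :: nat
      using D_le[OF that] ratio[OF that] by (simp add: g_def)
  qed (use assms in \<open>auto simp: g_def intro!: prod_nonneg\<close>)
  then show ?thesis
    by (simp add: g_def)
qed

text \<open>
  The induction runs over all multiplicities at once because the recursion refers to all
  \<open>r - k\<close>. The exponent \<open>1/N\<close> stays fixed along the induction.
\<close>

lemma D_le_of_factor_ratios:
  assumes "n \<ge> 1" "n \<le> Suc N" "N \<ge> 1" "r \<ge> 1"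
    and "\<And>t. t \<in> {1..<n} \<Longrightarrow> i t \<le> s t"
    and "\<And>t (j::nat) (k::nat). t \<in> {1..<n} \<Longrightarrow> 1 \<le> j \<Longrightarrow> j \<le> k \<Longrightarrow>
      (real j / real k) powr (1 / N) * (real (s t) - i t / k) \<le> real (s t) - i t / j"
  shows "real (D n r i s) \<le> (\<Prod>t=1..n. real (s t)) - (\<Prod>t=1..n. real (s t) - i t / r)"
  using assms
proof (induction n arbitrary: r rule: nat_induct_at_least)
  case base
  have "real (D 1 r i s) \<le> real (i 1 div r)" by simp
  also have "\<dots> \<le> i 1 / r" by (rule of_nat_div_le_of_nat)
  finally show ?case by simp
next
  case (Suc n)
  have nonneg: "0 \<le> real (s t) - i t / k" if "t \<in> {1..n}" "k \<ge> 1" for t and k :: nat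
  proof -
    have "real (i t) / k \<le> i t / 1"
      using that by (intro divide_left_mono) auto
    also have "\<dots> \<le> s t" using Suc.prems(4)[of t] that by simp
    finally show ?thesis by simp
  qed
  show ?case
  proof (rule D_Suc_le_prod)
    show "j / r * (\<Prod>t=1..n. real (s t) - i t / r) \<le> (\<Prod>t=1..n. real (s t) - i t / j)"
      if "1 \<le> j" "j \<le> r" for j :: nat
      by (rule prod_ratio_le[where N = N]) (use that Suc.prems nonneg in auto)
    show "real (D n j i s) \<le> (\<Prod>t=1..n. real (s t)) - (\<Prod>t=1..n. real (s t) - i t / j)"
      if "1 \<le> j" "j \<le> r" for j :: nat
      by (rule Suc.IH) (use that Suc.prems in auto)
  qed (use Suc nonneg in auto)
qed

section \<open>The bound on \<open>D\<close>\<close>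

theorem theorem17:
  fixes m r :: nat and i s :: "nat \<Rightarrow> nat"
  assumes "m \<ge> 3" and "r \<ge> 2"
    and "\<And>t. t \<in> {1..m} \<Longrightarrow> s t > 0"
    and "i m < r * s m"
    and "\<And>t. t \<in> {1..m-1} \<Longrightarrow>
      real (i t) \<le> real (s t) *
        min ((root (m-1) (real r) - 1) / (root (m-1) (real r) - 1 / real r))
            ((root (m-2) 2 - 1) / (root (m-2) 2 - 1 / 2))"
  shows "real (D m r i s) \<le>
    (\<Prod>t=1..m. real (s t)) - (\<Prod>t=1..m. real (s t) - real (i t) / real r)"
proof -
  define n where "n = m - 1"
  define N where "N = m - 2"
  have n: "n \<ge> 2" "Suc n = m" and N: "N \<ge> 1" "n = Suc N"
    using \<open>m \<ge> 3\<close> by (auto simp: n_def N_def)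
  have root_r: "root n r > 1" "root n r = r powr (1 / n)"
    and root_2: "root N 2 > 1" "root N 2 = 2 powr (1 / N)"
    using n N \<open>r \<ge> 2\<close> by (auto simp: root_powr_inverse)
  have bounds: "i t \<le> s t * ((root n r - 1) / (root n r - 1 / r))"
    "i t \<le> s t * ((root N 2 - 1) / (root N 2 - 1 / 2))" if "t \<in> {1..n}" for t
  proof -
    have le: "real (i t) \<le> s t * min ((root n r - 1) / (root n r - 1 / r))
        ((root N 2 - 1) / (root N 2 - 1 / 2))"
      using assms(5)[of t] that by (simp add: n_def N_def)
    show "i t \<le> s t * ((root n r - 1) / (root n r - 1 / r))"
      "i t \<le> s t * ((root N 2 - 1) / (root N 2 - 1 / 2))"
      by (rule order_trans[OF le], rule mult_left_mono, simp, simp)+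
  qed
  have le: "real (i t) \<le> s t" if "t \<in> {1..n}" for t
    by (rule weight_condition_imp_le[OF _ root_2(1) _ bounds(2)[OF that]]) auto
  have ends_r: "s t - i t / r \<le> r powr (1 / n) * (s t - real (i t))" if "t \<in> {1..n}" for t
    using bounds(1)[OF that] weight_condition_iff[of r "root n r" "i t" "s t"] root_r \<open>r \<ge> 2\<close>
    by simp
  have ends: "s t - i t / k \<le> k powr (1 / N) * (s t - real (i t))"
    if "t \<in> {1..n}" "k \<ge> 1" for t and k :: nat
    using bounds(2)[OF that(1)] weight_condition_iff[of 2 "root N 2" "i t" "s t"] root_2 N that
    by (intro endpoint_comparison_from_two) auto
  have nonneg: "0 \<le> real (s t) - i t / r" if "t \<in> {1..n}" for t
  proof -
    have "real (i t) / r \<le> i t / 1"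
      using \<open>r \<ge> 2\<close> by (intro divide_left_mono) auto
    then show ?thesis using le[OF that] by simp
  qed
  have "real (D (Suc n) r i s)
      \<le> (\<Prod>t=1..Suc n. real (s t)) - (\<Prod>t=1..Suc n. real (s t) - i t / r)"
  proof (rule D_Suc_le_prod)
    fix j :: nat assume j: "1 \<le> j" "j \<le> r"
    show "j / r * (\<Prod>t=1..n. real (s t) - i t / r) \<le> (\<Prod>t=1..n. real (s t) - i t / j)"
    proof (rule prod_ratio_le[where N = n])
      show "(j / r) powr (1 / n) * (real (s t) - i t / r) \<le> real (s t) - i t / j"
        if "t \<in> {1..n}" for t
        by (rule factor_ratio_le) (use n j ends_r[OF that] in auto)
    qed (use n j nonneg in auto)
    show "real (D n j i s) \<le> (\<Prod>t=1..n. real (s t)) - (\<Prod>t=1..n. real (s t) - i t / j)"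
    proof (rule D_le_of_factor_ratios[where N = N])
      show "(real l / real k) powr (1 / N) * (real (s t) - i t / k) \<le> real (s t) - i t / l"
        if "t \<in> {1..<n}" "1 \<le> l" "l \<le> k" for t l k
        by (rule factor_ratio_le) (use N that ends[of t k] in auto)
    qed (use n N j le in auto)
  qed (use n nonneg \<open>r \<ge> 2\<close> in auto)
  then show ?thesis
    using n by simp
qed

end
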